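(* Let $T$ be a tree containing a vertex $x$ such that $\deg(x)\ge 5$, $\deg(w)=2$ for each $w\in N_T(x)$, and $\mathrm{dist}_T(x,a)\ge 3$ for any leaf vertex $a$ of $T$. Then $NI(T)$ is not the edge ideal of any rooted hypertree.
   Context: All graphs are finite and simple; a tree is a connected graph with no cycles, a leaf is a vertex of degree $1$, $N_T(x)$ is the set of neighbors of $x$, $N_T[x]=N_T(x)\cup\{x\}$, and $\mathrm{dist}_T$ is the graph distance. With the vertices of $T$ regarded as variables of a polynomial ring over a field $\mathbb{K}$, $NI(T)=\langle\prod_{y\in N_T[v]}y: v\in V(T)\rangle$ is the closed neighborhood ideal. For a hypergraph $\mathcal{H}$ with vertex set $V(\mathcal{H})$ and edge set $E(\mathcal{H})$, its edge ideal is $I(\mathcal{H})=\langle\prod_{v\in\mathcal{E}}x_v:\mathcal{E}\in E(\mathcal{H})\rangle$. A host graph of $\mathcal{H}$ is a graph $H$ on the vertex set $V(\mathcal{H})$ such that for each $\mathcal{E}\in E(\mathcal{H})$ the induced subgraph $H[\mathcal{E}]$ is connected. A hypertree is a hypergraph admitting a tree as a host graph. A hypertree $\mathcal{H}$ is a rooted hypertree if there exist a vertex $z$ of $\mathcal{H}$ and a host tree $H$ of $\mathcal{H}$ such that every edge of $\mathcal{H}$ consists of vertices lying at pairwise distinct distances from $z$ in $H$. *)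

theory Defs
  imports
    "Graph_Theory.Graph_Theory"
    "HOL-Algebra.Ideal"
    "HOL-Library.Poly_Mapping"
begin

section \<open>Graphs and trees\<close>

text \<open>
  Finite simple graphs are the \<^locale>\<open>pair_graph\<close>s of the library: finite, loop-free, symmetric
  digraphs, an edge \<open>{u, v}\<close> being represented by the two arcs \<open>(u, v)\<close> and \<open>(v, u)\<close>.
\<close>

definition neighbors :: "'v pair_pre_digraph \<Rightarrow> 'v \<Rightarrow> 'v set" where
  "neighbors G x = {y. (x, y) \<in> parcs G}"

definition closed_neighbors :: "'v pair_pre_digraph \<Rightarrow> 'v \<Rightarrow> 'v set" where
  "closed_neighbors G x = insert x (neighbors G x)"

definition graph_degree :: "'v pair_pre_digraph \<Rightarrow> 'v \<Rightarrow> nat" where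
  "graph_degree G x = card (neighbors G x)"

definition leaf :: "'v pair_pre_digraph \<Rightarrow> 'v \<Rightarrow> bool" where
  "leaf G a \<longleftrightarrow> a \<in> pverts G \<and> graph_degree G a = 1"

text \<open>
  The library constant \<^const>\<open>Digraph_Component.tree\<close> is about digraph cycles, and each edge of a
  symmetric digraph yields the digraph cycle \<open>(u, v), (v, u)\<close>. The cycles of an undirected
  graph are the digraph cycles of length at least 3.
\<close>

definition graph_tree :: "'v pair_pre_digraph \<Rightarrow> bool" where
  "graph_tree G \<longleftrightarrow> pair_graph G \<and> Digraph_Component.connected (with_proj G) \<and>
     (\<nexists>p. pre_digraph.cycle (with_proj G) p \<and> 3 \<le> length p)"

definition graph_dist :: "'v pair_pre_digraph \<Rightarrow> 'v \<Rightarrow> 'v \<Rightarrow> ereal" where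
  "graph_dist G u v = wf_digraph.\<mu> (with_proj G) (\<lambda>_. 1) u v"


section \<open>Rooted hypertrees\<close>

record 'v hypergraph =
  hverts :: "'v set"
  hedges :: "'v set set"

definition wf_hypergraph :: "'v hypergraph \<Rightarrow> bool" where
  "wf_hypergraph H \<longleftrightarrow> finite (hverts H) \<and> (\<forall>e\<in>hedges H. e \<subseteq> hverts H)"

text \<open>A connected graph of the library is nonempty, so only nonempty hyperedges can be hosted.\<close>

definition host_graph :: "'v pair_pre_digraph \<Rightarrow> 'v hypergraph \<Rightarrow> bool" where
  "host_graph G H \<longleftrightarrow> pair_graph G \<and> pverts G = hverts H \<and>
     (\<forall>e\<in>hedges H. Digraph_Component.connected (with_proj G \<restriction> e))"

definition host_tree :: "'v pair_pre_digraph \<Rightarrow> 'v hypergraph \<Rightarrow> bool" where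
  "host_tree G H \<longleftrightarrow> host_graph G H \<and> graph_tree G"

definition hypertree :: "'v hypergraph \<Rightarrow> bool" where
  "hypertree H \<longleftrightarrow> wf_hypergraph H \<and> (\<exists>G. host_tree G H)"

definition rooted_hypertree :: "'v hypergraph \<Rightarrow> bool" where
  "rooted_hypertree H \<longleftrightarrow> hypertree H \<and>
     (\<exists>z\<in>hverts H. \<exists>G. host_tree G H \<and> (\<forall>e\<in>hedges H. inj_on (graph_dist G z) e))"


section \<open>Squarefree monomial ideals\<close>

text \<open>
  A polynomial is a finitely supported map from monomials to coefficients, a monomial a finitely
  supported map from variables to exponents. \<open>poly_ring V\<close> is the polynomial ring with variable set
  \<open>V\<close>, as a subring of the ring of all polynomials with variables in \<^typ>\<open>'v\<close>.
\<close>

definition poly_ring :: "'v set \<Rightarrow> (('v \<Rightarrow>\<^sub>0 nat) \<Rightarrow>\<^sub>0 'k::field) ring" where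
  "poly_ring V = \<lparr>carrier = {p. \<forall>m\<in>Poly_Mapping.keys p. Poly_Mapping.keys m \<subseteq> V}, mult = (*), one = 1, zero = 0, add = (+)\<rparr>"

definition pvar :: "'v \<Rightarrow> ('v \<Rightarrow>\<^sub>0 nat) \<Rightarrow>\<^sub>0 'k::field" where
  "pvar v = Poly_Mapping.single (Poly_Mapping.single v 1) 1"

text \<open>
  A nonzero ideal of \<open>poly_ring V\<close> involves every variable of \<open>V\<close> and no other, so two nonzero
  ideals can be equal as sets only if they are ideals of the same ring. In particular
  \<open>closed_neighborhood_ideal T = edge_ideal H\<close> with \<open>T\<close> nonempty entails
  \<open>pverts T = hverts H\<close>.
\<close>

definition edge_ideal :: "'v hypergraph \<Rightarrow> (('v \<Rightarrow>\<^sub>0 nat) \<Rightarrow>\<^sub>0 'k::field) set" where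
  "edge_ideal H = Idl\<^bsub>poly_ring (hverts H)\<^esub> {\<Prod>v\<in>e. pvar v | e. e \<in> hedges H}"

definition closed_neighborhood_ideal ::
    "'v pair_pre_digraph \<Rightarrow> (('v \<Rightarrow>\<^sub>0 nat) \<Rightarrow>\<^sub>0 'k::field) set" where
  "closed_neighborhood_ideal T =
     Idl\<^bsub>poly_ring (pverts T)\<^esub> {\<Prod>y\<in>closed_neighbors T v. pvar y | v. v \<in> pverts T}"

lemma poly_ring_simps:
  "p \<in> carrier (poly_ring V) \<longleftrightarrow> (\<forall>m\<in>Poly_Mapping.keys p. Poly_Mapping.keys m \<subseteq> V)"
  "p \<otimes>\<^bsub>poly_ring V\<^esub> q = p * q"
  "p \<oplus>\<^bsub>poly_ring V\<^esub> q = p + q"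
  "\<one>\<^bsub>poly_ring V\<^esub> = 1"
  "\<zero>\<^bsub>poly_ring V\<^esub> = 0"
  by (simp_all add: poly_ring_def)

lemma poly_ring_cring: "cring (poly_ring V :: (('v \<Rightarrow>\<^sub>0 nat) \<Rightarrow>\<^sub>0 'k::field) ring)"
proof -
  let ?R = "poly_ring V :: (('v \<Rightarrow>\<^sub>0 nat) \<Rightarrow>\<^sub>0 'k) ring"
  have plus: "p + q \<in> carrier ?R" if "p \<in> carrier ?R" "q \<in> carrier ?R" for p q
    using that Poly_Mapping.keys_add[of p q] unfolding poly_ring_simps by blast
  have times: "p * q \<in> carrier ?R" if "p \<in> carrier ?R" "q \<in> carrier ?R" for p q
    unfolding poly_ring_simps
  proof
    fix m assume "m \<in> Poly_Mapping.keys (p * q)"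
    then obtain a b where ab: "m = a + b" "a \<in> Poly_Mapping.keys p" "b \<in> Poly_Mapping.keys q"
      using keys_mult[of p q] by blast
    then have "Poly_Mapping.keys a \<subseteq> V" "Poly_Mapping.keys b \<subseteq> V"
      using that unfolding poly_ring_simps by blast+
    then show "Poly_Mapping.keys m \<subseteq> V"
      using Poly_Mapping.keys_add[of a b] ab(1) by blast
  qed
  have one: "1 \<in> carrier ?R" and zero: "0 \<in> carrier ?R"
    by (simp_all add: poly_ring_simps)
  have "abelian_group ?R"
  proof (rule abelian_groupI)
    fix p assume "p \<in> carrier ?R"
    then have "- p \<in> carrier ?R" by (simp add: poly_ring_simps)
    then show "\<exists>q\<in>carrier ?R. q \<oplus>\<^bsub>?R\<^esub> p = \<zero>\<^bsub>?R\<^esub>"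
      by (intro bexI[of _ "- p"]) (simp_all add: poly_ring_simps(3,5))
  qed (simp_all add: poly_ring_simps(3,5) plus zero add_ac)
  moreover have "comm_monoid ?R"
    by (rule comm_monoidI) (simp_all add: poly_ring_simps(2,4) times one mult_ac)
  ultimately show ?thesis
    by (rule cringI) (simp add: poly_ring_simps(2,3) distrib_right)
qed

end

theory Submission
  imports Defs
begin

text \<open>
  Minimal elements among the supports of squarefree monomial generators can be read off the ideal
  they generate. In a tree, an inclusion \<open>N[u] \<subseteq> N[v]\<close> with \<open>u \<noteq> v\<close> forces \<open>u\<close> to be a leaf adjacent
  to \<open>v\<close>, since a further neighbour of \<open>u\<close> would close a triangle. The hypotheses on \<open>x\<close> exclude
  leaves within distance 2 of \<open>x\<close>, so \<open>N[x]\<close> and \<open>N[w]\<close>, for each neighbour \<open>w\<close> of \<open>x\<close>, are minimal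
  closed neighbourhoods. Hence they are edges of every hypergraph \<open>H\<close> with \<open>NI(T)\<close> as edge ideal
  (\<open>closed_neighbors_hyperedge\<close>).

  Suppose that \<open>H\<close> is rooted, with host tree \<open>G\<close> and root \<open>z\<close>. The edge \<open>N[w]\<close> has three vertices,
  among them \<open>x\<close> and \<open>w\<close>, and it is connected in \<open>G\<close>, so the distances of \<open>w\<close> and \<open>x\<close> from \<open>z\<close>
  differ by at most 2. On the edge \<open>N[x]\<close> the distances from \<open>z\<close> are pairwise distinct. Therefore
  the neighbours of \<open>x\<close> have distinct distances among the four values \<open>d - 2\<close>, \<open>d - 1\<close>, \<open>d + 1\<close>,
  \<open>d + 2\<close>, where \<open>d\<close> is the distance of \<open>x\<close> from \<open>z\<close>; but \<open>x\<close> has at least five neighbours.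
\<close>

section \<open>Squarefree monomial ideals\<close>

lemma keys_add_nat:
  "Poly_Mapping.keys (m + n :: 'v \<Rightarrow>\<^sub>0 nat) = Poly_Mapping.keys m \<union> Poly_Mapping.keys n"
  by (auto simp: in_keys_iff lookup_add)

lemma keys_sum_single:
  "finite e \<Longrightarrow> Poly_Mapping.keys (\<Sum>v\<in>e. Poly_Mapping.single v (1::nat)) = e"
proof (induction e rule: finite_induct)
  case (insert a e)
  then show ?case by (simp add: keys_add_nat)
qed simp

lemma prod_pvar:
  "(\<Prod>v\<in>e. pvar v :: ('v \<Rightarrow>\<^sub>0 nat) \<Rightarrow>\<^sub>0 'k::field)
     = Poly_Mapping.single (\<Sum>v\<in>e. Poly_Mapping.single v 1) 1"
proof (induction e rule: infinite_finite_induct)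
  case (insert a e)
  then show ?case by (simp add: pvar_def mult_single)
qed simp_all

lemma keys_prod_pvar:
  "Poly_Mapping.keys (\<Prod>v\<in>e. pvar v :: ('v \<Rightarrow>\<^sub>0 nat) \<Rightarrow>\<^sub>0 'k::field)
     = {\<Sum>v\<in>e. Poly_Mapping.single v 1}"
  by (simp add: prod_pvar)

text \<open>
  The polynomials all of whose monomials are divisible by the squarefree monomial of some member
  of \<open>E\<close>. This ideal contains the generators, so it bounds the ideal they generate from above and
  yields the membership test \<open>prod_pvar_mem_IdlD\<close>.
\<close>

lemma ideal_divisible_monomials:
  "ideal {p \<in> carrier (poly_ring V :: (('v \<Rightarrow>\<^sub>0 nat) \<Rightarrow>\<^sub>0 'k::field) ring).
            \<forall>m\<in>Poly_Mapping.keys p. \<exists>e\<in>E. e \<subseteq> Poly_Mapping.keys m} (poly_ring V)"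
    (is "ideal ?J ?R")
proof -
  interpret R: cring ?R by (rule poly_ring_cring)
  have mult: "p * q \<in> ?J" if p: "p \<in> carrier ?R" and q: "q \<in> ?J" for p q
  proof (intro CollectI conjI ballI)
    show "p * q \<in> carrier ?R"
      using R.m_closed[of p q] p q by (simp add: poly_ring_simps(2))
    fix m assume "m \<in> Poly_Mapping.keys (p * q)"
    then obtain a b where ab: "m = a + b" "b \<in> Poly_Mapping.keys q"
      using keys_mult[of p q] by blast
    then obtain e where "e \<in> E" "e \<subseteq> Poly_Mapping.keys b" using q by blast
    then show "\<exists>e\<in>E. e \<subseteq> Poly_Mapping.keys m"
      unfolding ab(1) by (auto simp: keys_add_nat)
  qed
  have minus: "\<ominus>\<^bsub>?R\<^esub> p = - p" if "p \<in> carrier ?R" for p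
    using that by (intro R.minus_equality) (simp_all add: poly_ring_simps)
  have "subgroup ?J (add_monoid ?R)"
  proof (rule subgroup.intro)
    fix p q assume pq: "p \<in> ?J" "q \<in> ?J"
    have "p + q \<in> carrier ?R"
      using R.a_closed[of p q] pq by (simp add: poly_ring_simps(3))
    moreover have "\<exists>e\<in>E. e \<subseteq> Poly_Mapping.keys m" if "m \<in> Poly_Mapping.keys (p + q)" for m
      using that pq Poly_Mapping.keys_add[of p q] by blast
    ultimately show "p \<otimes>\<^bsub>add_monoid ?R\<^esub> q \<in> ?J"
      by (simp add: poly_ring_simps(3))
  next
    show "\<one>\<^bsub>add_monoid ?R\<^esub> \<in> ?J" using R.zero_closed by (simp add: poly_ring_simps(5))
  next
    fix p assume p: "p \<in> ?J"
    then have "inv\<^bsub>add_monoid ?R\<^esub> p = - p" using minus by (simp add: a_inv_def)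
    then show "inv\<^bsub>add_monoid ?R\<^esub> p \<in> ?J" using p by (simp add: poly_ring_simps(1))
  qed auto
  then show ?thesis
  proof (rule idealI[OF R.ring_axioms])
    fix q p assume "q \<in> ?J" "p \<in> carrier ?R"
    with mult[of p q] have "p * q \<in> ?J" by blast
    then show "p \<otimes>\<^bsub>?R\<^esub> q \<in> ?J" "q \<otimes>\<^bsub>?R\<^esub> p \<in> ?J"
      by (simp_all only: poly_ring_simps(2) mult.commute[of q p])
  qed
qed

lemma prod_pvar_carrier:
  "finite e \<Longrightarrow> e \<subseteq> V \<Longrightarrow> (\<Prod>v\<in>e. pvar v) \<in> carrier (poly_ring V)"
  by (simp add: poly_ring_simps(1) keys_prod_pvar keys_sum_single[simplified])

lemma prod_pvar_mem_IdlI: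
  assumes "\<And>e. e \<in> E \<Longrightarrow> finite e \<and> e \<subseteq> V" and "e \<in> E"
  shows "(\<Prod>v\<in>e. pvar v :: ('v \<Rightarrow>\<^sub>0 nat) \<Rightarrow>\<^sub>0 'k::field)
           \<in> Idl\<^bsub>poly_ring V\<^esub> {\<Prod>v\<in>e. pvar v | e. e \<in> E}"
proof -
  interpret R: cring "poly_ring V :: (('v \<Rightarrow>\<^sub>0 nat) \<Rightarrow>\<^sub>0 'k) ring" by (rule poly_ring_cring)
  have "{\<Prod>v\<in>e. pvar v | e. e \<in> E} \<subseteq> carrier (poly_ring V :: (('v \<Rightarrow>\<^sub>0 nat) \<Rightarrow>\<^sub>0 'k) ring)"
    using assms(1) by (auto intro: prod_pvar_carrier)
  from R.genideal_self[OF this] show ?thesis using assms(2) by blast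
qed

lemma prod_pvar_mem_IdlD:
  assumes fin: "\<And>e. e \<in> E \<Longrightarrow> finite e \<and> e \<subseteq> V" and "finite f"
    and mem: "(\<Prod>v\<in>f. pvar v :: ('v \<Rightarrow>\<^sub>0 nat) \<Rightarrow>\<^sub>0 'k::field)
           \<in> Idl\<^bsub>poly_ring V\<^esub> {\<Prod>v\<in>e. pvar v | e. e \<in> E}"
  obtains e where "e \<in> E" "e \<subseteq> f"
proof -
  interpret R: cring "poly_ring V :: (('v \<Rightarrow>\<^sub>0 nat) \<Rightarrow>\<^sub>0 'k) ring" by (rule poly_ring_cring)
  let ?J = "{p \<in> carrier (poly_ring V :: (('v \<Rightarrow>\<^sub>0 nat) \<Rightarrow>\<^sub>0 'k) ring).
    \<forall>m\<in>Poly_Mapping.keys p. \<exists>e\<in>E. e \<subseteq> Poly_Mapping.keys m}"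
  have "{\<Prod>v\<in>e. pvar v | e. e \<in> E} \<subseteq> ?J"
    using fin by (auto simp: keys_prod_pvar keys_sum_single[simplified] intro!: prod_pvar_carrier)
  from R.genideal_minimal[OF ideal_divisible_monomials this] mem
  have "(\<Prod>v\<in>f. pvar v) \<in> ?J" by blast
  then show ?thesis using that \<open>finite f\<close> by (auto simp: keys_prod_pvar keys_sum_single[simplified])
qed

section \<open>Closed neighbourhoods in trees\<close>

context
  fixes T :: "'v pair_pre_digraph"
  assumes tree: "graph_tree T"
begin

interpretation T: pair_graph T
  using tree by (simp add: graph_tree_def)

lemma neighbors_sym: "y \<in> neighbors T x \<longleftrightarrow> x \<in> neighbors T y"
  unfolding neighbors_def
  using T.pair_sym_arcs by (auto simp: symmetric_def sym_def)

lemma neighbors_irrefl: "x \<notin> neighbors T x"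
  unfolding neighbors_def using T.pair_no_loops by fastforce

lemma neighbors_subset: "neighbors T x \<subseteq> pverts T"
  unfolding neighbors_def using T.in_arcsD2 by auto

lemma finite_neighbors: "finite (neighbors T x)"
  by (rule finite_subset[OF neighbors_subset T.pair_finite_verts])

lemma no_triangle:
  assumes "b \<in> neighbors T a" "c \<in> neighbors T b" "a \<in> neighbors T c"
  shows False
proof -
  have arcs: "(a, b) \<in> parcs T" "(b, c) \<in> parcs T" "(c, a) \<in> parcs T"
    using assms by (auto simp: neighbors_def)
  moreover have "a \<noteq> b" "b \<noteq> c" "c \<noteq> a" using assms neighbors_irrefl by auto
  ultimately have "T.cycle [(a, b), (b, c), (c, a)]"
    unfolding T.cycle_def T.awalk_def
    by (intro exI[of _ a]) (auto dest: T.in_arcsD1 T.in_arcsD2)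
  then show False using tree unfolding graph_tree_def by fastforce
qed

lemma closed_neighbors_subset_imp_leaf:
  assumes "u \<in> pverts T" "closed_neighbors T u \<subseteq> closed_neighbors T v" "u \<noteq> v"
  shows "leaf T u \<and> u \<in> neighbors T v"
proof -
  have u: "u \<in> neighbors T v" using assms by (auto simp: closed_neighbors_def)
  have "y = v" if y: "y \<in> neighbors T u" for y
    using y assms(2) no_triangle[OF u y] neighbors_sym
    by (auto simp: closed_neighbors_def)
  then have "neighbors T u = {v}" using u neighbors_sym by blast
  then show ?thesis using u assms(1) by (simp add: leaf_def graph_degree_def)
qed

lemma closed_neighbors_hyperedge:
  fixes H :: "'v hypergraph"
  assumes wf: "wf_hypergraph H"
    and eq: "(closed_neighborhood_ideal T :: (('v \<Rightarrow>\<^sub>0 nat) \<Rightarrow>\<^sub>0 'k::field) set) = edge_ideal H"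
    and v: "v \<in> pverts T" and no_leaf: "\<And>u. u \<in> neighbors T v \<Longrightarrow> \<not> leaf T u"
  shows "closed_neighbors T v \<in> hedges H"
proof -
  let ?N = "closed_neighbors T ` pverts T"
  have N: "finite e \<and> e \<subseteq> pverts T" if "e \<in> ?N" for e
    using that finite_neighbors neighbors_subset by (auto simp: closed_neighbors_def)
  have E: "finite e \<and> e \<subseteq> hverts H" if "e \<in> hedges H" for e
    using wf that by (auto simp: wf_hypergraph_def intro: finite_subset)
  have NI: "(closed_neighborhood_ideal T :: (('v \<Rightarrow>\<^sub>0 nat) \<Rightarrow>\<^sub>0 'k) set)
    = Idl\<^bsub>poly_ring (pverts T)\<^esub> {\<Prod>y\<in>e. pvar y | e. e \<in> ?N}"
    unfolding closed_neighborhood_ideal_def by (rule arg_cong[where f="genideal _"]) blast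
  have "(\<Prod>y\<in>closed_neighbors T v. pvar y)
      \<in> (edge_ideal H :: (('v \<Rightarrow>\<^sub>0 nat) \<Rightarrow>\<^sub>0 'k) set)"
    unfolding eq[symmetric] NI by (rule prod_pvar_mem_IdlI[OF N]) (use v in auto)
  then obtain e where e: "e \<in> hedges H" "e \<subseteq> closed_neighbors T v"
    unfolding edge_ideal_def by (rule prod_pvar_mem_IdlD[OF E, rotated 2]) (use N v in auto)
  have "(\<Prod>y\<in>e. pvar y) \<in> (closed_neighborhood_ideal T :: (('v \<Rightarrow>\<^sub>0 nat) \<Rightarrow>\<^sub>0 'k) set)"
    unfolding eq edge_ideal_def by (rule prod_pvar_mem_IdlI[OF E e(1)])
  then obtain u where u: "u \<in> pverts T" "closed_neighbors T u \<subseteq> e"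
    unfolding NI by (rule prod_pvar_mem_IdlD[OF N, rotated 2]) (use E[OF e(1)] in auto)
  \<comment> \<open>Now \<open>N[u] \<subseteq> e \<subseteq> N[v]\<close>, and minimality of \<open>N[v]\<close> collapses the chain.\<close>
  have "u = v" using closed_neighbors_subset_imp_leaf[of u v] no_leaf u e by blast
  then show ?thesis using u e by auto
qed

end

section \<open>Distances\<close>

context pair_graph
begin

lemma awalk_cost_one: "awalk_cost (\<lambda>_. 1) p = real (length p)"
  by (simp add: awalk_cost_def sum_list_triv)

lemma graph_dist_le_length: "awalk u p v \<Longrightarrow> graph_dist G u v \<le> real (length p)"
  using min_cost_le_walk_cost[of u p v "\<lambda>_. 1"] by (simp add: graph_dist_def awalk_cost_one)

lemma graph_dist_eq_length:
  assumes "u \<rightarrow>\<^sup>*\<^bsub>with_proj G\<^esub> v"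
  obtains p where "awalk u p v" "graph_dist G u v = real (length p)"
proof -
  have "\<exists>p. apath u p v \<and> \<mu> (\<lambda>_. 1) u v = awalk_cost (\<lambda>_. 1) p"
    using assms by (rule no_neg_cyc_reach_imp_path) (auto simp: awalk_cost_one)
  then show ?thesis
    using that by (auto simp: apath_def graph_dist_def awalk_cost_one)
qed

end

lemma pair_graph_connected_reachable:
  assumes "pair_graph G" "Digraph_Component.connected (with_proj G)" "u \<in> pverts G" "v \<in> pverts G"
  shows "u \<rightarrow>\<^sup>*\<^bsub>with_proj G\<^esub> v"
proof -
  interpret pair_graph G by fact
  show ?thesis
    using assms(2-4) reachable_mk_symmetric_eq[OF pair_sym_arcs]
    by (auto simp: Digraph_Component.connected_def strongly_connected_def mk_symmetric_def)
qed

text \<open>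
  Distances in a connected graph are finite, so they can be taken as integers, for which the
  differences needed below are well behaved.
\<close>

lemma connected_graph_dist_int:
  assumes G: "pair_graph G" and conn: "Digraph_Component.connected (with_proj G)"
    and z: "z \<in> pverts G"
  obtains d :: "'v \<Rightarrow> int" where
    "\<And>v. v \<in> pverts G \<Longrightarrow> graph_dist G z v = ereal (of_int (d v))"
    "\<And>u v. (u, v) \<in> parcs G \<Longrightarrow> \<bar>d u - d v\<bar> \<le> 1"
proof -
  interpret pair_graph G by fact
  have "\<exists>p. awalk z p v \<and> graph_dist G z v = real (length p)" if "v \<in> pverts G" for v
    using graph_dist_eq_length[of z v] pair_graph_connected_reachable[OF G conn z that] by blast
  then obtain p where p: "awalk z (p v) v" "graph_dist G z v = real (length (p v))"
    if "v \<in> pverts G" for v by metis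
  define d where "d v = int (length (p v))" for v
  have d: "graph_dist G z v = ereal (of_int (d v))" if "v \<in> pverts G" for v
    using p(2)[OF that] by (simp add: d_def)
  have le: "d v \<le> d u + 1" if "(u, v) \<in> parcs G" for u v
  proof -
    have uv: "u \<in> pverts G" "v \<in> pverts G" using that in_arcsD1 in_arcsD2 by auto
    have "awalk u [(u, v)] v" using that uv by (simp add: awalk_def)
    then have "awalk z (p u @ [(u, v)]) v" using p(1)[OF uv(1)] by (rule awalk_appendI[rotated])
    from graph_dist_le_length[OF this] show ?thesis
      unfolding d[OF uv(2)] by (simp add: d_def)
  qed
  have "\<bar>d u - d v\<bar> \<le> 1" if "(u, v) \<in> parcs G" for u v
  proof -
    have "(v, u) \<in> parcs G" using that pair_sym_arcs by (auto simp: symmetric_def sym_def)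
    then show ?thesis using le[OF that] le[of v u] by linarith
  qed
  with d show ?thesis by (rule that)
qed

lemma connected_induced_crossing:
  assumes "pair_graph G" and conn: "Digraph_Component.connected (with_proj G \<restriction> e)"
    and "x \<in> S" "x \<in> e" "y \<in> e" "y \<notin> S"
  obtains a b where "(a, b) \<in> parcs G" "a \<in> S \<inter> e" "b \<in> e - S"
proof -
  interpret pair_graph G by fact
  let ?K = "mk_symmetric (with_proj G \<restriction> e)"
  have K: "(a, b) \<in> parcs G \<and> a \<in> e \<and> b \<in> e" if "(a, b) \<in> parcs ?K" for a b
    using that pair_sym_arcs by (auto simp: mk_symmetric_def symmetric_def sym_def)
  have "x \<rightarrow>\<^sup>*\<^bsub>with_proj ?K\<^esub> y"
    using conn assms(4,5)
    by (auto simp: Digraph_Component.connected_def strongly_connected_def mk_symmetric_def)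
  then have "(x, y) \<in> rtrancl_on (pverts ?K) (parcs ?K)" by (simp add: reachable_def)
  then have "\<exists>a b. (a, b) \<in> parcs ?K \<and> a \<in> S \<and> b \<notin> S"
    using \<open>x \<in> S\<close> \<open>y \<notin> S\<close> by (induction rule: rtrancl_on_induct) blast+
  then show ?thesis using K that by blast
qed

text \<open>
  Inside a connected triple, \<open>x\<close> reaches \<open>w\<close> directly or through \<open>u\<close>: the set \<open>{x}\<close> must be left
  towards \<open>w\<close> or \<open>u\<close>, and the set \<open>{x, u}\<close> towards \<open>w\<close>.
\<close>

lemma connected_triple_diff_le_2:
  fixes d :: "'v \<Rightarrow> int"
  assumes G: "pair_graph G" and conn: "Digraph_Component.connected (with_proj G \<restriction> {x, w, u})"
    and "x \<noteq> w" "u \<noteq> w"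
    and lip: "\<And>a b. (a, b) \<in> parcs G \<Longrightarrow> \<bar>d a - d b\<bar> \<le> 1"
  shows "\<bar>d w - d x\<bar> \<le> 2"
proof -
  obtain a where a: "(x, a) \<in> parcs G" "a = w \<or> a = u"
    by (rule connected_induced_crossing[OF G conn, of x "{x}" w]) (use \<open>x \<noteq> w\<close> in auto)
  obtain b where b: "(b, w) \<in> parcs G" "b = x \<or> b = u"
    by (rule connected_induced_crossing[OF G conn, of x "{x, u}" w])
      (use \<open>x \<noteq> w\<close> \<open>u \<noteq> w\<close> in auto)
  show ?thesis using a(2) b(2) lip[OF a(1)] lip[OF b(1)] by auto
qed

lemma second_neighbor_not_leaf:
  assumes tree: "graph_tree T" and "w \<in> neighbors T x" "a \<in> neighbors T w"
    and far: "\<forall>a. leaf T a \<longrightarrow> graph_dist T x a \<ge> 3"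
  shows "\<not> leaf T a"
proof
  assume "leaf T a"
  interpret T: pair_graph T using tree by (simp add: graph_tree_def)
  have "T.awalk x [(x, w), (w, a)] a"
    using assms(2,3) by (auto simp: T.awalk_def neighbors_def dest: T.in_arcsD1)
  then have "graph_dist T x a \<le> real (length [(x, w), (w, a)])" by (rule T.graph_dist_le_length)
  then have "graph_dist T x a \<le> ereal 2" by simp
  moreover have "ereal 3 \<le> graph_dist T x a" using far \<open>leaf T a\<close> by auto
  ultimately have "ereal 3 \<le> ereal 2" by (rule order_trans[rotated])
  then show False by simp
qed

section \<open>Too many neighbours for a rooted hypertree\<close>

theorem proposition3p6:
  fixes T :: "'v pair_pre_digraph" and x :: 'v
  assumes "graph_tree T"
    and "x \<in> pverts T"
    and "graph_degree T x \<ge> 5"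
    and "\<forall>w\<in>neighbors T x. graph_degree T w = 2"
    and "\<forall>a. leaf T a \<longrightarrow> graph_dist T x a \<ge> 3"
  shows "\<nexists>H :: 'v hypergraph. rooted_hypertree H \<and>
    (closed_neighborhood_ideal T :: (('v \<Rightarrow>\<^sub>0 nat) \<Rightarrow>\<^sub>0 'k::field) set) = edge_ideal H"
proof
  assume "\<exists>H :: 'v hypergraph. rooted_hypertree H \<and>
    (closed_neighborhood_ideal T :: (('v \<Rightarrow>\<^sub>0 nat) \<Rightarrow>\<^sub>0 'k::field) set) = edge_ideal H"
  then obtain H :: "'v hypergraph" where rooted: "rooted_hypertree H"
    and eq: "(closed_neighborhood_ideal T :: (('v \<Rightarrow>\<^sub>0 nat) \<Rightarrow>\<^sub>0 'k::field) set) = edge_ideal H"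
    by blast
  note edge = closed_neighbors_hyperedge[OF assms(1) _ eq]
  have wf: "wf_hypergraph H" using rooted by (simp add: rooted_hypertree_def hypertree_def)
  obtain z G where z: "z \<in> hverts H" and host: "host_tree G H"
    and inj: "\<And>e. e \<in> hedges H \<Longrightarrow> inj_on (graph_dist G z) e"
    using rooted unfolding rooted_hypertree_def by blast
  from host have G: "pair_graph G" "Digraph_Component.connected (with_proj G)"
    and verts: "pverts G = hverts H"
    and conn: "\<And>e. e \<in> hedges H \<Longrightarrow> Digraph_Component.connected (with_proj G \<restriction> e)"
    by (auto simp: host_tree_def host_graph_def graph_tree_def)
  obtain d :: "'v \<Rightarrow> int" where
    d: "\<And>v. v \<in> pverts G \<Longrightarrow> graph_dist G z v = ereal (of_int (d v))"
    and lip: "\<And>a b. (a, b) \<in> parcs G \<Longrightarrow> \<bar>d a - d b\<bar> \<le> 1"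
    using connected_graph_dist_int[OF G, of z] z verts by blast

  have "closed_neighbors T x \<in> hedges H"
    by (rule edge[OF wf assms(2)]) (use assms(4) in \<open>auto simp: leaf_def\<close>)
  then have "inj_on (graph_dist G z) (closed_neighbors T x)" "closed_neighbors T x \<subseteq> pverts G"
    using inj wf verts by (auto simp: wf_hypergraph_def)
  then have inj_d: "inj_on d (closed_neighbors T x)"
    using d by (auto simp: inj_on_def subset_iff)

  have near: "\<bar>d w - d x\<bar> \<le> 2" if w: "w \<in> neighbors T x" for w
  proof -
    have x: "x \<in> neighbors T w" using w neighbors_sym[OF assms(1)] by blast
    have "card (neighbors T w) = 2" using assms(4) w by (simp add: graph_degree_def)
    then obtain a b where "neighbors T w = {a, b}" by (auto simp: card_2_iff)
    with x obtain u where u: "neighbors T w = {x, u}" by (cases "x = a") auto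
    have N: "closed_neighbors T w = {x, w, u}" using u by (auto simp: closed_neighbors_def)
    have "x \<noteq> w" "u \<noteq> w" using u neighbors_irrefl[OF assms(1), of w] by auto
    have "closed_neighbors T w \<in> hedges H"
      by (rule edge[OF wf]) (use w neighbors_subset[OF assms(1)] second_neighbor_not_leaf[OF assms(1) w]
          assms(5) in auto)
    then show ?thesis
      using connected_triple_diff_le_2[OF G(1) _ \<open>x \<noteq> w\<close> \<open>u \<noteq> w\<close> lip] conn N by auto
  qed
  have "d w \<noteq> d x" if "w \<in> neighbors T x" for w
    using inj_d that neighbors_irrefl[OF assms(1), of x]
    by (auto simp: inj_on_def closed_neighbors_def)
  then have "d ` neighbors T x \<subseteq> {d x - 2, d x - 1, d x + 1, d x + 2}"
    using near by force
  then have "card (d ` neighbors T x) \<le> card {d x - 2, d x - 1, d x + 1, d x + 2}"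
    by (intro card_mono) auto
  also have "\<dots> \<le> 4" by (simp add: card_insert_if)
  finally have "card (d ` neighbors T x) \<le> 4" .
  moreover have "card (d ` neighbors T x) = card (neighbors T x)"
    by (rule card_image) (use inj_d in \<open>auto simp: inj_on_def closed_neighbors_def\<close>)
  ultimately show False using assms(3) by (simp add: graph_degree_def)
qed

end
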